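(* Let $A \in \mathbb{R}^{m\times n}$, $B\in \mathbb{R}^{l\times n}$, and assume $B$ is injective. Then, for any $p \in [2,\infty)$, $$\|A\|_{p\mapsto 1;B} \leq \frac{1}{2}\min_{(v,w)\in K} \left(\|v\|_{1}+\|w\|_{\frac{p}{p-2}}\right) \leq \frac{\gamma_p}{\gamma_1} \|A\|_{p\mapsto 1;B},$$ where $$K := \left\{(v,w) \in \mathbb{R}^{m}\times \mathbb{R}^{l} \;\middle|\; \begin{bmatrix}\operatorname{Diag}(v) & -A\\-A^\top & B^\top\operatorname{Diag}(w)B\end{bmatrix} \succeq 0\right\},$$ and $\gamma_s = \left(\frac{2^{s/2}}{\sqrt{\pi}}\Gamma\left(\frac{s+1}{2}\right)\right)^{1/s}$ for $s\in[1,\infty)$, with $\Gamma$ the Euler Gamma function.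
   Context: $\|A\|_{p\mapsto 1;B} := \max_{x\in\mathbb{R}^n,\ \|Bx\|_p\leq 1} \|Ax\|_1$, where $\|\cdot\|_p$ is the vector $p$-norm. A matrix is injective if the linear map it represents is injective. $\operatorname{Diag}(v)$ is the diagonal matrix with the entries of $v$ on its diagonal, and $\succeq 0$ means positive semidefinite. For $p=2$ the exponent $\frac{p}{p-2}$ is read as $\infty$. *)

theory Defs
  imports "HOL-Analysis.Analysis"
begin

text \<open>The vector \<open>q\<close>-norm for \<open>1 \<le> q \<le> \<infinity>\<close>. Recall that \<open>infnorm x\<close> is the largest modulus
  of an entry of \<open>x\<close>.\<close>

definition pnorm :: "ereal \<Rightarrow> real ^ 'k \<Rightarrow> real" where
  "pnorm q x =
     (if q = \<infinity> then infnorm x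
      else (\<Sum>i\<in>UNIV. \<bar>x $ i\<bar> powr real_of_ereal q) powr (1 / real_of_ereal q))"

text \<open>The exponent \<open>p / (p - 2)\<close>, read as \<open>\<infinity>\<close> for \<open>p = 2\<close>.\<close>

definition dual_half_exponent :: "real \<Rightarrow> ereal" where
  "dual_half_exponent p = (if p = 2 then \<infinity> else ereal (p / (p - 2)))"

text \<open>\<open>\<parallel>A\<parallel>\<close> from \<open>p\<close> to \<open>1\<close> relative to \<open>B\<close>. \<^const>\<open>Greatest\<close> is a maximum: its value is meaningful
  only if the maximum is attained.\<close>

definition opnorm_p1 :: "real \<Rightarrow> real ^ 'n ^ 'm \<Rightarrow> real ^ 'n ^ 'l \<Rightarrow> real" where
  "opnorm_p1 p A B =
     (GREATEST c. \<exists>x. pnorm (ereal p) (B *v x) \<le> 1 \<and> c = pnorm 1 (A *v x))"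

definition diag_matrix :: "real ^ 'k \<Rightarrow> real ^ 'k ^ 'k" where
  "diag_matrix v = (\<chi> i j. if i = j then v $ i else 0)"

text \<open>The block matrix with first block row \<open>P, Q\<close> and second block row \<open>R, S\<close>; \<open>Inl\<close> and \<open>Inr\<close>
  tag the indices of the first and second block.\<close>

definition block_matrix ::
  "real ^ 'a ^ 'c \<Rightarrow> real ^ 'b ^ 'c \<Rightarrow> real ^ 'a ^ 'd \<Rightarrow> real ^ 'b ^ 'd \<Rightarrow>
     real ^ ('a + 'b) ^ ('c + 'd)" where
  "block_matrix P Q R S =
     (\<chi> i j. case i of
        Inl c \<Rightarrow> (case j of Inl a \<Rightarrow> P $ c $ a | Inr b \<Rightarrow> Q $ c $ b)
      | Inr d \<Rightarrow> (case j of Inl a \<Rightarrow> R $ d $ a | Inr b \<Rightarrow> S $ d $ b))"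

definition pos_semidef :: "real ^ 'k ^ 'k \<Rightarrow> bool" where
  "pos_semidef M \<longleftrightarrow> transpose M = M \<and> (\<forall>x. 0 \<le> x \<bullet> (M *v x))"

definition feasible_K :: "real ^ 'n ^ 'm \<Rightarrow> real ^ 'n ^ 'l \<Rightarrow> ((real ^ 'm) \<times> (real ^ 'l)) set" where
  "feasible_K A B =
     {(v, w). pos_semidef
        (block_matrix (diag_matrix v) (- A)
                      (- transpose A) (transpose B ** diag_matrix w ** B))}"

definition sdp_objective :: "real \<Rightarrow> (real ^ 'm) \<times> (real ^ 'l) \<Rightarrow> real" where
  "sdp_objective p = (\<lambda>(v, w). pnorm 1 v + pnorm (dual_half_exponent p) w)"

definition gamma_const :: "real \<Rightarrow> real" where
  "gamma_const s = (2 powr (s / 2) / sqrt pi * Gamma ((s + 1) / 2)) powr (1 / s)"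

end

theory Submission
  imports Defs "HOL-Probability.Probability"
begin

text \<open>Let \<open>N\<close> be the operator norm and write \<open>\<gamma>\<close> for \<^const>\<open>gamma_const\<close>.

  The first inequality is weak duality. For \<open>(v, w) \<in> K\<close> and \<open>x\<close> in the unit ball, the quadratic form of the
  block matrix at \<open>(y, x)\<close>, with \<open>y\<close> the signs of \<open>A x\<close>, is nonnegative, and Hoelder's inequality with the exponents \<open>p / (p - 2)\<close> and
  \<open>p / 2\<close> gives \<open>2 * pnorm 1 (A x) \<le> sdp_objective p (v, w)\<close> (lemma \<open>sdp_objective_ge\<close>).

  For the second inequality, the dual of the semidefinite programme asks to maximise the sum of the square roots of the
  diagonal entries of \<open>A X A\<^sup>T\<close> over positive semidefinite \<open>X\<close> for which the diagonal of \<open>B X B\<^sup>T\<close> has norm at most 1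
  with exponent \<open>p / 2\<close>. Only these two diagonals matter, and they range over the convex cone generated by the vectors
  \<open>((A x) i)\<^sup>2, ((B x) j)\<^sup>2\<close>. Because \<open>B\<close> is injective, the maximum \<open>D\<close> is attained, at \<open>(\<alpha>, c)\<close>
  say (lemma \<open>extremal_moment\<close>). Optimality along the rays \<open>(\<alpha>, c) + t ((A x)\<^sup>2, (B x)\<^sup>2)\<close> yields, as \<open>t \<rightarrow> 0\<close>,
  that \<open>v i = sqrt (\<alpha> i)\<close> and \<open>w j = D * c j powr (p / 2 - 1)\<close>, read as \<open>D\<close> for \<open>p = 2\<close>, form a pair in \<open>K\<close>; its objective is \<open>2 * D\<close>
  (lemmas \<open>first_order_condition\<close> and \<open>dual_certificate\<close>). Hence half the minimum is at most \<open>D\<close>.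

  It remains to see \<open>\<gamma> 1 * D \<le> \<gamma> p * N\<close> (lemma \<open>moment_rounding\<close>). Let \<open>x\<close> be a centred Gaussian vector whose
  covariance is an optimal \<open>X\<close>. Then \<open>(A x) i\<close> has variance \<open>\<alpha> i\<close> and \<open>(B x) j\<close> has variance \<open>c j\<close>, and \<open>\<gamma> s powr s\<close>
  is the absolute moment of order \<open>s\<close> of a standard normal variable. So the expectation of \<open>pnorm 1 (A x)\<close> is
  \<open>\<gamma> 1 * D\<close>, and that of \<open>pnorm p (B x)\<close> is at most \<open>\<gamma> p\<close>.\<close>

section \<open>Vector norms and Hoelder's inequality\<close>

lemma pnorm_ereal: "pnorm (ereal q) x = (\<Sum>i\<in>UNIV. \<bar>x $ i\<bar> powr q) powr (1 / q)"
  by (simp add: pnorm_def)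

lemma pnorm_1: "pnorm 1 x = (\<Sum>i\<in>UNIV. \<bar>x $ i\<bar>)"
  by (simp add: pnorm_def sum_nonneg)

lemma pnorm_nonneg: "0 \<le> pnorm q x"
  by (simp add: pnorm_def infnorm_pos_le)

lemma abs_component_le_pnorm:
  assumes "0 < q"
  shows "\<bar>x $ i\<bar> \<le> pnorm q x"
proof (cases q)
  case (real r)
  then have r: "0 < r" using assms by simp
  have "\<bar>x $ i\<bar> = (\<bar>x $ i\<bar> powr r) powr (1 / r)"
    using r by (simp add: powr_powr)
  also have "\<dots> \<le> pnorm q x"
    unfolding real pnorm_ereal using r by (intro powr_mono2 member_le_sum) auto
  finally show ?thesis .
qed (use assms in \<open>auto simp: pnorm_def component_le_infnorm_cart\<close>)

lemma continuous_on_pnorm [continuous_intros]: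
  assumes "0 < q" "continuous_on S f"
  shows "continuous_on S (\<lambda>x. pnorm q (f x))"
proof (cases q)
  case (real r)
  then have r: "0 < r" using assms by simp
  show ?thesis
    unfolding real pnorm_ereal using r
    by (intro continuous_on_powr' continuous_intros assms ballI conjI sum_nonneg impI) auto
qed (use assms in \<open>auto simp: pnorm_def intro!: continuous_intros\<close>)

lemma pnorm_scaleR:
  assumes "0 < q"
  shows "pnorm q (t *\<^sub>R x) = \<bar>t\<bar> * pnorm q x"
proof (cases q)
  case (real r)
  then have r: "0 < r" using assms by simp
  have "pnorm q (t *\<^sub>R x) = (\<bar>t\<bar> powr r * (\<Sum>i\<in>UNIV. \<bar>x $ i\<bar> powr r)) powr (1 / r)"
    unfolding real pnorm_ereal by (simp add: abs_mult powr_mult sum_distrib_left)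
  also have "\<dots> = \<bar>t\<bar> * pnorm q x"
    unfolding real pnorm_ereal using r by (simp add: powr_mult powr_powr sum_nonneg)
  finally show ?thesis .
qed (use assms in \<open>auto simp: pnorm_def infnorm_mul\<close>)

lemma pnorm_eq_0_iff:
  assumes "0 < q"
  shows "pnorm q x = 0 \<longleftrightarrow> x = 0"
proof
  assume "pnorm q x = 0"
  then have "\<bar>x $ i\<bar> \<le> 0" for i using abs_component_le_pnorm[OF assms, of x i] by simp
  then show "x = 0" by (simp add: vec_eq_iff)
next
  assume "x = 0"
  then show "pnorm q x = 0" using pnorm_scaleR[OF assms, of 0 x] by simp
qed

lemma dual_half_exponent_pos: "2 \<le> p \<Longrightarrow> 0 < dual_half_exponent p"
  by (auto simp: dual_half_exponent_def)

text \<open>Hoelder's inequality for the conjugate exponents \<open>p / (p - 2)\<close> and \<open>p / 2\<close>, applied to \<open>w\<close> and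
  the entrywise square of \<open>b\<close>. It follows by summing Young's inequality over the entries of \<open>w\<close>
  divided by its norm; for \<open>p = 2\<close> it is the pairing of the maximum norm with the 1-norm.\<close>
lemma Holder_squares:
  fixes w b :: "real ^ 'l"
  assumes p: "2 \<le> p" and b: "pnorm (ereal p) b \<le> 1"
  shows "(\<Sum>j\<in>UNIV. w $ j * (b $ j)\<^sup>2) \<le> pnorm (dual_half_exponent p) w"
proof -
  define W where "W = pnorm (dual_half_exponent p) w"
  have comp: "\<bar>w $ j\<bar> \<le> W" for j
    unfolding W_def by (intro abs_component_le_pnorm dual_half_exponent_pos p)
  have W: "0 \<le> W" by (simp add: W_def pnorm_nonneg)
  have "(\<Sum>j\<in>UNIV. \<bar>b $ j\<bar> powr p) = ((\<Sum>j\<in>UNIV. \<bar>b $ j\<bar> powr p) powr (1 / p)) powr p"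
    using p by (simp add: powr_powr sum_nonneg)
  also have "\<dots> \<le> 1 powr p"
    using b p unfolding pnorm_ereal by (intro powr_mono2) auto
  finally have b_sum: "(\<Sum>j\<in>UNIV. \<bar>b $ j\<bar> powr p) \<le> 1" by simp
  show ?thesis
  proof (cases "p = 2")
    case True
    have "(\<Sum>j\<in>UNIV. w $ j * (b $ j)\<^sup>2) \<le> (\<Sum>j\<in>UNIV. W * \<bar>b $ j\<bar> powr p)"
    proof (rule sum_mono)
      fix j
      have "\<bar>b $ j\<bar> powr p = (b $ j)\<^sup>2" by (simp add: True)
      then show "w $ j * (b $ j)\<^sup>2 \<le> W * \<bar>b $ j\<bar> powr p"
        using comp[of j] by (simp add: mult_right_mono)
    qed
    also have "\<dots> \<le> W"
      using b_sum W by (simp add: sum_distrib_left[symmetric] mult_left_le)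
    finally show ?thesis by (simp add: W_def)
  next
    case False
    then have p2: "2 < p" using p by simp
    define q where "q = p / (p - 2)"
    have q: "1 < q" "1 / q + 1 / (p / 2) = 1" using p2 by (auto simp: q_def field_simps)
    have W_eq: "W = (\<Sum>j\<in>UNIV. \<bar>w $ j\<bar> powr q) powr (1 / q)"
      using False by (simp add: W_def dual_half_exponent_def pnorm_ereal q_def)
    show ?thesis
    proof (cases "W = 0")
      case True
      then have "w $ j = 0" for j using comp[of j] by simp
      then show ?thesis by (simp add: pnorm_nonneg)
    next
      case nz: False
      then have "0 < W" using W by simp
      have W_q: "W powr q = (\<Sum>j\<in>UNIV. \<bar>w $ j\<bar> powr q)"
        unfolding W_eq using q by (simp add: powr_powr sum_nonneg)
      have w_sum: "(\<Sum>j\<in>UNIV. (\<bar>w $ j\<bar> / W) powr q) = 1"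
        using \<open>0 < W\<close> by (simp add: powr_divide sum_divide_distrib[symmetric] flip: W_q)
      have sq: "((b $ j)\<^sup>2) powr (p / 2) = \<bar>b $ j\<bar> powr p" for j
      proof -
        have "(b $ j)\<^sup>2 = \<bar>b $ j\<bar> powr 2" by simp
        then show ?thesis by (simp only: powr_powr) simp
      qed
      have "(\<Sum>j\<in>UNIV. \<bar>w $ j\<bar> / W * (b $ j)\<^sup>2)
          \<le> (\<Sum>j\<in>UNIV. (\<bar>w $ j\<bar> / W) powr q / q + ((b $ j)\<^sup>2) powr (p / 2) / (p / 2))"
        using q p2 W by (intro sum_mono Youngs_inequality) auto
      also have "\<dots> = 1 / q + (\<Sum>j\<in>UNIV. \<bar>b $ j\<bar> powr p) / (p / 2)"
        by (simp only: sq sum.distrib sum_divide_distrib[symmetric] w_sum)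
      also have "\<dots> \<le> 1 / q + 1 / (p / 2)"
        using b_sum p2 by (intro add_left_mono divide_right_mono) auto
      finally have "(\<Sum>j\<in>UNIV. \<bar>w $ j\<bar> / W * (b $ j)\<^sup>2) \<le> 1"
        by (simp only: q)
      then have "(\<Sum>j\<in>UNIV. \<bar>w $ j\<bar> * (b $ j)\<^sup>2) \<le> W"
        using \<open>0 < W\<close> by (simp add: sum_divide_distrib[symmetric])
      moreover have "(\<Sum>j\<in>UNIV. w $ j * (b $ j)\<^sup>2) \<le> (\<Sum>j\<in>UNIV. \<bar>w $ j\<bar> * (b $ j)\<^sup>2)"
        by (intro sum_mono mult_right_mono) auto
      ultimately show ?thesis by (simp add: W_def)
    qed
  qed
qed

lemma norm_le_pnorm:
  fixes x :: "real ^ 'k"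
  assumes "0 < q"
  shows "norm x \<le> CARD('k) * pnorm q x"
proof -
  have "norm x \<le> (\<Sum>i\<in>UNIV. \<bar>x $ i\<bar>)" by (rule norm_le_l1_cart)
  also have "\<dots> \<le> (\<Sum>i\<in>(UNIV::'k set). pnorm q x)"
    by (intro sum_mono abs_component_le_pnorm assms)
  finally show ?thesis by simp
qed

section \<open>Attainment and homogeneity of the operator norm\<close>

text \<open>Injectivity of \<open>B\<close> bounds \<open>norm x\<close> by a multiple of \<open>norm (B x)\<close>, so the constraint set is compact.\<close>
lemma opnorm_attained:
  fixes A :: "real ^ 'n ^ 'm" and B :: "real ^ 'n ^ 'l"
  assumes B: "inj ((*v) B)" and p: "0 < p"
  shows "\<exists>x. pnorm (ereal p) (B *v x) \<le> 1 \<and>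
    (\<forall>x'. pnorm (ereal p) (B *v x') \<le> 1 \<longrightarrow> pnorm 1 (A *v x') \<le> pnorm 1 (A *v x))"
proof -
  define S where "S = {x. pnorm (ereal p) (B *v x) \<le> 1}"
  have q: "0 < ereal p" using p by simp
  have lin: "continuous_on T ((*v) M)" for T and M :: "real ^ 'n ^ 'k"
    by (rule matrix_vector_mult_linear_continuous_on)
  have "closed S" unfolding S_def by (intro closed_Collect_le continuous_intros q lin)
  moreover have "bounded S"
  proof -
    obtain e where e: "0 < e" "\<And>x. e * norm x \<le> norm (B *v x)"
      using linear_inj_bounded_below_pos[OF matrix_vector_mul_linear B] by blast
    have "norm x \<le> CARD('l) / e" if "x \<in> S" for x
    proof -
      have "e * norm x \<le> CARD('l) * pnorm (ereal p) (B *v x)"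
        using e(2) norm_le_pnorm[OF q] order_trans by blast
      also have "\<dots> \<le> real CARD('l) * 1" using that by (intro mult_left_mono) (auto simp: S_def)
      finally show ?thesis using e(1) by (simp add: field_simps)
    qed
    then show ?thesis by (rule boundedI)
  qed
  ultimately have "compact S" by (simp add: compact_eq_bounded_closed)
  moreover have "S \<noteq> {}"
  proof -
    have "pnorm (ereal p) (B *v 0) = 0" using pnorm_eq_0_iff[OF q, of "B *v 0"] by simp
    then show ?thesis by (auto simp: S_def intro!: exI[of _ 0])
  qed
  moreover have "continuous_on S (\<lambda>x. pnorm 1 (A *v x))"
    by (intro continuous_on_pnorm lin) simp
  ultimately obtain x where "x \<in> S" "\<forall>x'\<in>S. pnorm 1 (A *v x') \<le> pnorm 1 (A *v x)"
    using continuous_attains_sup by metis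
  then show ?thesis by (auto simp: S_def)
qed

text \<open>Homogeneity extends a bound on the unit ball of \<open>pnorm q (B x)\<close> to all \<open>x\<close>; injectivity of \<open>B\<close>
  excludes that this quantity vanishes at some \<open>x \<noteq> 0\<close>.\<close>
lemma pnorm_le_of_unit_bound:
  assumes B: "inj ((*v) B)" and q: "0 < q"
    and N: "\<And>x. pnorm q (B *v x) \<le> 1 \<Longrightarrow> pnorm 1 (A *v x) \<le> N"
  shows "pnorm 1 (A *v x) \<le> N * pnorm q (B *v x)"
proof (cases "x = 0")
  case True
  then show ?thesis using pnorm_eq_0_iff[OF q, of "B *v x"] by (simp add: pnorm_1)
next
  case False
  define r where "r = pnorm q (B *v x)"
  have "B *v x \<noteq> 0" using B False by (metis injD matrix_vector_mult_0_right)
  then have r: "0 < r" using pnorm_eq_0_iff[OF q, of "B *v x"] pnorm_nonneg[of q "B *v x"] by (simp add: r_def)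
  have "pnorm 1 (A *v (inverse r *\<^sub>R x)) \<le> N"
    by (rule N) (use r in \<open>simp add: matrix_vector_mult_scaleR pnorm_scaleR[OF q] flip: r_def\<close>)
  then have "inverse r * pnorm 1 (A *v x) \<le> N"
    using r by (simp add: matrix_vector_mult_scaleR pnorm_scaleR)
  then show ?thesis using r by (simp add: r_def[symmetric] field_simps)
qed

section \<open>The semidefinite constraint and weak duality\<close>

text \<open>Every vector indexed by \<open>'a + 'b\<close> is a stack of two blocks, so quadratic forms of block matrices
  can be expanded block by block.\<close>
definition stack :: "real ^ 'a \<Rightarrow> real ^ 'b \<Rightarrow> real ^ ('a + 'b)" where
  "stack y x = (\<chi> s. case s of Inl i \<Rightarrow> y $ i | Inr k \<Rightarrow> x $ k)"

lemma sum_UNIV_Plus: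
  "(\<Sum>s\<in>UNIV. f s) = (\<Sum>i\<in>UNIV. f (Inl i)) + (\<Sum>k\<in>UNIV. f (Inr k))"
  for f :: "'a::finite + 'b::finite \<Rightarrow> real"
  using sum.Plus[of "UNIV :: 'a set" "UNIV :: 'b set" f] by simp

lemma stack_exhaust: "\<exists>y x. z = stack y x"
proof -
  have "z = stack (\<chi> i. z $ Inl i) (\<chi> k. z $ Inr k)"
    by (auto simp: stack_def vec_eq_iff split: sum.split)
  then show ?thesis by blast
qed

lemma inner_stack: "stack y x \<bullet> stack y' x' = y \<bullet> y' + x \<bullet> x'"
  by (simp add: inner_vec_def sum_UNIV_Plus stack_def)

lemma block_matrix_mult_stack:
  "block_matrix P Q R S *v stack y x = stack (P *v y + Q *v x) (R *v y + S *v x)"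
  by (auto simp: vec_eq_iff block_matrix_def stack_def matrix_vector_mult_def sum_UNIV_Plus split: sum.split)

lemma transpose_block_matrix:
  "transpose (block_matrix P Q R S) = block_matrix (transpose P) (transpose R) (transpose Q) (transpose S)"
  by (auto simp: vec_eq_iff block_matrix_def transpose_def split: sum.split)

lemma transpose_diag_matrix: "transpose (diag_matrix v) = diag_matrix v"
  by (simp add: vec_eq_iff transpose_def diag_matrix_def)

lemma diag_matrix_mult: "diag_matrix v *v y = (\<chi> i. v $ i * y $ i)"
proof -
  have "(\<Sum>j\<in>UNIV. (if i = j then v $ i else 0) * y $ j) = v $ i * y $ i" for i
    by (simp add: if_distrib[of "\<lambda>z. z * _"] cong: if_cong)
  then show ?thesis by (simp add: vec_eq_iff diag_matrix_def matrix_vector_mult_def)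
qed

lemma inner_diag_matrix: "y \<bullet> (diag_matrix v *v y) = (\<Sum>i\<in>UNIV. v $ i * (y $ i)\<^sup>2)"
  by (simp add: diag_matrix_mult inner_vec_def power2_eq_square mult_ac)

lemma transpose_uminus: "transpose (- A) = - transpose A" for A :: "real ^ 'n ^ 'm"
  by (simp add: vec_eq_iff transpose_def)

lemma minus_matrix_mult: "(- A) *v x = - (A *v x)" for A :: "real ^ 'n ^ 'm"
  by (simp add: vec_eq_iff matrix_vector_mult_def sum_negf)

lemma inner_transpose_mult: "x \<bullet> (transpose A *v y) = (A *v x) \<bullet> y" for A :: "real ^ 'n ^ 'm"
  by (metis dot_lmul_matrix inner_commute transpose_matrix_vector)

text \<open>The quadratic form of the block matrix at the stacked vector \<open>(y, x)\<close> is the difference of the two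
  sides. In this form \<open>K\<close> is visibly closed: it is cut out by weak inequalities that are linear in \<open>(v, w)\<close>.\<close>
lemma feasible_K_iff:
  "(v, w) \<in> feasible_K A B \<longleftrightarrow>
     (\<forall>y x. 2 * (\<Sum>i\<in>UNIV. y $ i * (A *v x) $ i)
        \<le> (\<Sum>i\<in>UNIV. v $ i * (y $ i)\<^sup>2) + (\<Sum>j\<in>UNIV. w $ j * ((B *v x) $ j)\<^sup>2))"
proof -
  define M where "M = block_matrix (diag_matrix v) (- A) (- transpose A) (transpose B ** diag_matrix w ** B)"
  have "transpose M = M"
    by (simp add: M_def transpose_block_matrix transpose_diag_matrix transpose_uminus
        matrix_transpose_mul matrix_mul_assoc)
  moreover have "stack y x \<bullet> (M *v stack y x)
      = (\<Sum>i\<in>UNIV. v $ i * (y $ i)\<^sup>2) + (\<Sum>j\<in>UNIV. w $ j * ((B *v x) $ j)\<^sup>2)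
        - 2 * (\<Sum>i\<in>UNIV. y $ i * (A *v x) $ i)" for y x
  proof -
    have "x \<bullet> ((transpose B ** diag_matrix w ** B) *v x) = (\<Sum>j\<in>UNIV. w $ j * ((B *v x) $ j)\<^sup>2)"
      by (simp only: matrix_vector_mul_assoc[symmetric] inner_transpose_mult inner_diag_matrix)
    moreover have "x \<bullet> ((- transpose A) *v y) = - (y \<bullet> (A *v x))"
      by (simp only: minus_matrix_mult inner_minus_right inner_transpose_mult) (simp add: inner_commute)
    moreover have "y \<bullet> ((- A) *v x) = - (y \<bullet> (A *v x))"
      by (simp add: minus_matrix_mult)
    ultimately have "stack y x \<bullet> (M *v stack y x)
      = (\<Sum>i\<in>UNIV. v $ i * (y $ i)\<^sup>2) + (\<Sum>j\<in>UNIV. w $ j * ((B *v x) $ j)\<^sup>2) - 2 * (y \<bullet> (A *v x))"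
      by (simp only: M_def block_matrix_mult_stack inner_stack inner_add_right inner_diag_matrix)
    then show ?thesis by (simp add: inner_vec_def)
  qed
  ultimately have "pos_semidef M \<longleftrightarrow> (\<forall>y x. 2 * (\<Sum>i\<in>UNIV. y $ i * (A *v x) $ i)
        \<le> (\<Sum>i\<in>UNIV. v $ i * (y $ i)\<^sup>2) + (\<Sum>j\<in>UNIV. w $ j * ((B *v x) $ j)\<^sup>2))"
    unfolding pos_semidef_def by (metis (no_types, lifting) diff_ge_0_iff_ge stack_exhaust)
  then show ?thesis by (simp add: feasible_K_def M_def)
qed

text \<open>Testing the semidefinite constraint at a vector \<open>y\<close> of signs of the entries of \<open>A x\<close> turns the
  mixed term into the 1-norm of \<open>A x\<close>. All entries of \<open>y\<close> are \<open>1\<close> or \<open>-1\<close>, so the term with \<open>v\<close> is at most \<open>pnorm 1 v\<close>, and Hoelder's inequality controls the term with \<open>w\<close>.\<close>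
lemma sdp_objective_ge:
  assumes p: "2 \<le> p" and K: "(v, w) \<in> feasible_K A B" and x: "pnorm (ereal p) (B *v x) \<le> 1"
  shows "2 * pnorm 1 (A *v x) \<le> sdp_objective p (v, w)"
proof -
  define y :: "real ^ _" where "y = (\<chi> i. if 0 \<le> (A *v x) $ i then 1 else - 1)"
  have "2 * (\<Sum>i\<in>UNIV. y $ i * (A *v x) $ i)
        \<le> (\<Sum>i\<in>UNIV. v $ i * (y $ i)\<^sup>2) + (\<Sum>j\<in>UNIV. w $ j * ((B *v x) $ j)\<^sup>2)"
    using K by (simp add: feasible_K_iff)
  moreover have "(\<Sum>i\<in>UNIV. y $ i * (A *v x) $ i) = pnorm 1 (A *v x)"
    unfolding pnorm_1 by (intro sum.cong) (auto simp: y_def)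
  moreover have "(\<Sum>i\<in>UNIV. v $ i * (y $ i)\<^sup>2) \<le> pnorm 1 v"
    unfolding pnorm_1 by (intro sum_mono) (auto simp: y_def)
  ultimately show ?thesis
    using Holder_squares[OF p x, of w] by (simp add: sdp_objective_def)
qed

text \<open>The objective is a sum of norms, so its sublevel sets in the closed set \<open>K\<close> are compact.\<close>
lemma sdp_minimum_attained:
  fixes A :: "real ^ 'n ^ 'm" and B :: "real ^ 'n ^ 'l"
  assumes p: "2 \<le> p" and ne: "feasible_K A B \<noteq> {}"
  shows "\<exists>z\<in>feasible_K A B. \<forall>z'\<in>feasible_K A B. sdp_objective p z \<le> sdp_objective p z'"
proof -
  let ?K = "feasible_K A B" and ?q = "dual_half_exponent p"
  have q: "0 < ?q" by (rule dual_half_exponent_pos[OF p])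
  have obj: "sdp_objective p z = pnorm 1 (fst z) + pnorm ?q (snd z)" for z
    by (cases z) (simp add: sdp_objective_def)
  have cont: "continuous_on S (sdp_objective p)" for S
    unfolding obj[abs_def] by (intro continuous_intros q) auto
  have "?K = {z. \<forall>y x. 2 * (\<Sum>i\<in>UNIV. y $ i * (A *v x) $ i)
      \<le> (\<Sum>i\<in>UNIV. fst z $ i * (y $ i)\<^sup>2) + (\<Sum>j\<in>UNIV. snd z $ j * ((B *v x) $ j)\<^sup>2)}"
    by (auto simp: feasible_K_iff)
  also have "closed \<dots>"
    by (intro closed_Collect_all closed_Collect_le continuous_intros)
  finally have closed_K: "closed ?K" .
  obtain z0 where z0: "z0 \<in> ?K" using ne by blast
  define S where "S = {z \<in> ?K. sdp_objective p z \<le> sdp_objective p z0}"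
  have "closed S"
    unfolding S_def by (intro closed_Collect_conj[of "\<lambda>z. z \<in> ?K", simplified] closed_K closed_Collect_le cont continuous_intros)
  moreover have "bounded S"
  proof (rule boundedI)
    fix z assume "z \<in> S"
    then have le: "pnorm 1 (fst z) + pnorm ?q (snd z) \<le> sdp_objective p z0" by (simp add: S_def obj)
    have "norm z \<le> norm (fst z) + norm (snd z)" by (cases z) (simp add: norm_Pair_le)
    also have "\<dots> \<le> CARD('m) * pnorm 1 (fst z) + CARD('l) * pnorm ?q (snd z)"
      by (intro add_mono norm_le_pnorm q) auto
    also have "\<dots> \<le> CARD('m) * sdp_objective p z0 + CARD('l) * sdp_objective p z0"
      using le pnorm_nonneg[of 1 "fst z"] pnorm_nonneg[of ?q "snd z"]
      by (intro add_mono mult_left_mono) auto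
    finally show "norm z \<le> CARD('m) * sdp_objective p z0 + CARD('l) * sdp_objective p z0" .
  qed
  ultimately have "compact S" by (simp add: compact_eq_bounded_closed)
  moreover have "S \<noteq> {}" using z0 unfolding S_def by blast
  ultimately obtain z where z: "z \<in> S" "\<forall>z'\<in>S. sdp_objective p z \<le> sdp_objective p z'"
    using continuous_attains_inf[OF _ _ cont] by metis
  have "sdp_objective p z \<le> sdp_objective p z'" if "z' \<in> ?K" for z'
    using z that unfolding S_def by (cases z') (smt (verit) mem_Collect_eq)
  moreover have "z \<in> ?K" using z(1) unfolding S_def by blast
  ultimately show ?thesis by blast
qed

section \<open>Absolute moments of Gaussian linear forms\<close>

text \<open>The substitution \<open>t = x\<^sup>2 / 2\<close> turns half of the moment integral into Euler's integral for
  \<open>Gamma ((s + 1) / 2)\<close>; the other half is equal by symmetry.\<close>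
lemma std_normal_abs_moment:
  assumes s: "0 < s"
  shows "has_bochner_integral lborel (\<lambda>x. std_normal_density x * \<bar>x\<bar> powr s)
           (2 powr (s / 2) / sqrt pi * Gamma ((s + 1) / 2))"
proof -
  define f :: "real \<Rightarrow> real" where "f t = t powr ((s + 1) / 2 - 1) / exp t" for t
  \<comment> \<open>The constant relating the substituted Gamma integrand to the moment integrand.\<close>
  define c :: real where "c = sqrt (2 * pi) / 2 powr ((s - 1) / 2)"
  define h where "h x = std_normal_density x * \<bar>x\<bar> powr s" for x :: real
  have hpos: "0 \<le> h x" for x by (simp add: h_def)
  have f0: "(f has_integral Gamma ((s + 1) / 2)) {0..}"
    unfolding f_def using s by (intro Gamma_integral_real) auto
  have img: "(\<lambda>x::real. x\<^sup>2 / 2) ` {0..} = {0..}"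
  proof (intro set_eqI iffI)
    fix y :: real assume "y \<in> {0..}"
    then have "y = (sqrt (2 * y))\<^sup>2 / 2" "sqrt (2 * y) \<in> {0..}" by auto
    then show "y \<in> (\<lambda>x::real. x\<^sup>2 / 2) ` {0..}" by blast
  qed auto
  have inj: "inj_on (\<lambda>x::real. x\<^sup>2 / 2) {0..}"
    by (intro inj_onI) (simp add: power2_eq_iff_nonneg)
  have "f absolutely_integrable_on {0..}"
    using f0 by (intro nonnegative_absolutely_integrable_1) (auto simp: f_def)
  moreover have "integral {0..} f = Gamma ((s + 1) / 2)"
    using f0 by (rule integral_unique)
  ultimately have "f absolutely_integrable_on (\<lambda>x::real. x\<^sup>2 / 2) ` {0..} \<and>
      integral ((\<lambda>x::real. x\<^sup>2 / 2) ` {0..}) f = Gamma ((s + 1) / 2)"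
    unfolding img by simp
  then have "(\<lambda>x. \<bar>x\<bar> * f (x\<^sup>2 / 2)) absolutely_integrable_on {0..} \<and>
      integral {0..} (\<lambda>x. \<bar>x\<bar> * f (x\<^sup>2 / 2)) = Gamma ((s + 1) / 2)"
    by (subst has_absolute_integral_change_of_variables_1'[OF _ _ inj])
       (auto intro!: derivative_eq_intros)
  then have "((\<lambda>x. \<bar>x\<bar> * f (x\<^sup>2 / 2)) has_integral Gamma ((s + 1) / 2)) {0..}"
    by (auto simp: set_lebesgue_integral_eq_integral has_integral_integral
          dest: set_lebesgue_integral_eq_integral(1))
  moreover have "\<bar>x\<bar> * f (x\<^sup>2 / 2) = c * h x" if "x \<in> {0..}" for x
  proof (cases "x = 0")
    case False
    then have "0 < x" using that by auto
    have e: "(s + 1) / 2 - 1 = (s - 1) / 2" by (simp add: field_simps)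
    have "(x\<^sup>2 / 2) powr ((s + 1) / 2 - 1) = x powr (s - 1) / 2 powr ((s - 1) / 2)"
    proof -
      have "x\<^sup>2 powr ((s - 1) / 2) = x powr (2 * ((s - 1) / 2))"
        using \<open>0 < x\<close> by (simp only: powr_powr flip: powr_numeral)
      also have "2 * ((s - 1) / 2) = s - 1" by simp
      finally show ?thesis using e by (simp add: powr_divide)
    qed
    moreover have "x powr s = x * x powr (s - 1)"
      using \<open>0 < x\<close> by (simp add: powr_diff)
    ultimately show ?thesis
      using \<open>0 < x\<close> by (simp add: f_def h_def c_def std_normal_density_def exp_minus field_simps)
  qed (use s in \<open>simp add: h_def\<close>)
  ultimately have "((\<lambda>x. c * h x) has_integral Gamma ((s + 1) / 2)) {0..}"
    by (rule has_integral_eq[rotated])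
  then have "((\<lambda>x. (1 / c) * (c * h x)) has_integral (1 / c) * Gamma ((s + 1) / 2)) {0..}"
    by (rule has_integral_mult_right)
  moreover have "c > 0" by (simp add: c_def)
  ultimately have "(h has_integral Gamma ((s + 1) / 2) / c) {0..}"
    by simp
  then have "(\<integral>\<^sup>+x. ennreal (indicator {0..} x *\<^sub>R h x) \<partial>lborel) = ennreal (Gamma ((s + 1) / 2) / c)"
    using nn_integral_has_integral_lebesgue[OF hpos] by (simp add: ennreal_mult' ennreal_indicator)
  then have "has_bochner_integral lborel (\<lambda>x. indicator {0..} x *\<^sub>R h x) (Gamma ((s + 1) / 2) / c)"
    using \<open>c > 0\<close> s by (intro has_bochner_integral_nn_integral) (auto simp: h_def intro!: Gamma_real_pos less_imp_le)
  then have "has_bochner_integral lborel h (2 *\<^sub>R (Gamma ((s + 1) / 2) / c))"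
    by (rule has_bochner_integral_even_function) (simp add: h_def std_normal_density_def)
  also have "2 *\<^sub>R (Gamma ((s + 1) / 2) / c) = 2 powr (s / 2) / sqrt pi * Gamma ((s + 1) / 2)"
  proof -
    have "2 powr (s / 2) * sqrt 2 = 2 * 2 powr ((s - 1) / 2)"
    proof -
      have "2 powr (s / 2) * sqrt 2 = 2 powr (s / 2 + 1 / 2)"
        by (simp add: powr_add powr_half_sqrt)
      also have "s / 2 + 1 / 2 = 1 + (s - 1) / 2" by (simp add: field_simps)
      finally show ?thesis by (simp only: powr_add) simp
    qed
    then have "2 * 2 powr ((s - 1) / 2) / sqrt 2 = 2 powr (s / 2)"
      by (simp add: nonzero_divide_eq_eq)
    moreover have "2 *\<^sub>R (Gamma ((s + 1) / 2) / c)
        = (2 * 2 powr ((s - 1) / 2) / sqrt 2) / sqrt pi * Gamma ((s + 1) / 2)"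
      by (simp add: c_def real_sqrt_mult)
    ultimately show ?thesis by simp
  qed
  finally show ?thesis by (simp add: h_def[abs_def])
qed

lemma gamma_const_powr:
  assumes "0 < s"
  shows "gamma_const s powr s = 2 powr (s / 2) / sqrt pi * Gamma ((s + 1) / 2)"
  using assms by (simp add: gamma_const_def powr_powr Gamma_real_pos)

lemma gamma_const_pos:
  assumes "0 < s"
  shows "0 < gamma_const s"
proof -
  have "0 < Gamma ((s + 1) / 2)" using assms by (intro Gamma_real_pos) auto
  then show ?thesis by (simp add: gamma_const_def)
qed

abbreviation gauss :: "'i set \<Rightarrow> ('i \<Rightarrow> real) measure" where
  "gauss I \<equiv> PiM I (\<lambda>_. density lborel std_normal_density)"

lemma prob_space_gauss: "prob_space (gauss I)"
  by (intro prob_space_PiM prob_space_normal_density) simp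

lemma gauss_coordinate:
  assumes "i \<in> I"
  shows "distributed (gauss I) lborel (\<lambda>\<omega>. \<omega> i) std_normal_density"
proof -
  have "distr (gauss I) (density lborel std_normal_density) (\<lambda>\<omega>. \<omega> i) = density lborel std_normal_density"
    by (intro distr_PiM_component assms prob_space_normal_density) simp
  moreover have "distr (gauss I) (density lborel std_normal_density) (\<lambda>\<omega>. \<omega> i) = distr (gauss I) lborel (\<lambda>\<omega>. \<omega> i)"
    by (intro distr_cong) auto
  moreover have "(\<lambda>\<omega>. \<omega> i) \<in> measurable (gauss I) lborel"
    using measurable_component_singleton[OF assms, of "\<lambda>_. density lborel std_normal_density"] by simp
  ultimately show ?thesis by (simp add: distributed_def)
qed

lemma gauss_coordinates_indep:
  assumes "I \<noteq> {}"
  shows "prob_space.indep_vars (gauss I) (\<lambda>_. borel) (\<lambda>i \<omega>. \<omega> i) I"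
proof -
  interpret prob_space "gauss I" by (rule prob_space_gauss)
  have rv: "random_variable borel (\<lambda>\<omega>. \<omega> i)" if "i \<in> I" for i
    using measurable_component_singleton[OF that, of "\<lambda>_. density lborel std_normal_density"] by simp
  have d: "distr (gauss I) borel (\<lambda>\<omega>. \<omega> i) = density lborel std_normal_density" if "i \<in> I" for i
    using gauss_coordinate[OF that] by (simp add: distributed_def cong: distr_cong)
  have "distr (gauss I) (PiM I (\<lambda>_. borel)) (\<lambda>\<omega>. \<lambda>i\<in>I. \<omega> i) = distr (gauss I) (gauss I) (\<lambda>\<omega>. \<omega>)"
    by (intro distr_cong sets_PiM_cong) (auto simp: space_PiM PiE_restrict)
  also have "\<dots> = gauss I" by (rule distr_id)
  also have "\<dots> = PiM I (\<lambda>i. distr (gauss I) borel (\<lambda>\<omega>. \<omega> i))"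
    by (intro PiM_cong) (auto simp: d)
  finally show ?thesis
    by (subst indep_vars_iff_distr_eq_PiM'[OF assms rv])
qed

text \<open>A linear form in independent standard normal variables is normal with mean zero, and its variance is
  the sum of the squared coefficients. Vanishing coefficients are dropped first, because a
  degenerate normal distribution has no density.\<close>
lemma gauss_linear_form_moment:
  assumes I: "finite I" and s: "0 < s"
  shows "has_bochner_integral (gauss I) (\<lambda>\<omega>. \<bar>\<Sum>i\<in>I. \<omega> i * a i\<bar> powr s)
           (gamma_const s powr s * (\<Sum>i\<in>I. (a i)\<^sup>2) powr (s / 2))"
proof -
  define J where "J = {i \<in> I. a i \<noteq> 0}"
  have J: "finite J" "J \<subseteq> I" using I by (auto simp: J_def)
  have sum_J: "(\<Sum>i\<in>I. \<omega> i * a i) = (\<Sum>i\<in>J. \<omega> i * a i)" for \<omega>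
    using I by (intro sum.mono_neutral_right) (auto simp: J_def)
  have sq_J: "(\<Sum>i\<in>I. (a i)\<^sup>2) = (\<Sum>i\<in>J. (a i)\<^sup>2)"
    using I by (intro sum.mono_neutral_right) (auto simp: J_def)
  show ?thesis
  proof (cases "J = {}")
    case True
    then show ?thesis by (simp add: sum_J sq_J has_bochner_integral_zero)
  next
    case False
    interpret prob_space "gauss I" by (rule prob_space_gauss)
    define \<sigma> where "\<sigma> = sqrt (\<Sum>i\<in>J. (a i)\<^sup>2)"
    have "0 < (\<Sum>i\<in>J. (a i)\<^sup>2)"
      using False J by (intro sum_pos) (auto simp: J_def)
    then have \<sigma>: "\<sigma> > 0" "\<sigma>\<^sup>2 = (\<Sum>i\<in>J. (a i)\<^sup>2)" by (auto simp: \<sigma>_def)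
    have "indep_vars (\<lambda>_. borel) (\<lambda>i \<omega>. \<omega> i) J"
      using gauss_coordinates_indep[of I] False J by (intro indep_vars_subset[OF _ J(2)]) auto
    then have ind: "indep_vars (\<lambda>_. borel) (\<lambda>i \<omega>. \<omega> i * a i) J"
      by (rule indep_vars_compose2) simp
    have nrm: "distributed (gauss I) lborel (\<lambda>\<omega>. \<omega> i * a i) (normal_density 0 \<bar>a i\<bar>)" if "i \<in> J" for i
      using normal_density_affine[OF gauss_coordinate[of i I], of "a i" 0] that
      by (simp add: J_def mult.commute)
    have "distributed (gauss I) lborel (\<lambda>\<omega>. \<Sum>i\<in>J. \<omega> i * a i) (normal_density 0 \<sigma>)"
      using sum_indep_normal[OF J(1) False ind _ nrm] by (simp add: J_def \<sigma>_def)
    then have D: "distributed (gauss I) lborel (\<lambda>\<omega>. (\<Sum>i\<in>J. \<omega> i * a i) / \<sigma>) std_normal_density"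
      using normal_standard_normal_convert[OF \<sigma>(1), of _ 0] by simp
    have "has_bochner_integral (gauss I) (\<lambda>\<omega>. \<bar>(\<Sum>i\<in>J. \<omega> i * a i) / \<sigma>\<bar> powr s) (gamma_const s powr s)"
      using std_normal_abs_moment[OF s] distributed_integral[OF D, of "\<lambda>x. \<bar>x\<bar> powr s"]
        distributed_integrable[OF D, of "\<lambda>x. \<bar>x\<bar> powr s"] s
      by (simp add: has_bochner_integral_iff gamma_const_powr)
    then have "has_bochner_integral (gauss I) (\<lambda>\<omega>. \<sigma> powr s * \<bar>(\<Sum>i\<in>J. \<omega> i * a i) / \<sigma>\<bar> powr s)
        (\<sigma> powr s * gamma_const s powr s)"
      by (rule has_bochner_integral_mult_right)
    moreover have "\<sigma> powr s = (\<Sum>i\<in>J. (a i)\<^sup>2) powr (s / 2)"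
      unfolding \<sigma>(2)[symmetric] using \<sigma>(1) by (simp add: powr_powr flip: powr_numeral)
    moreover have "\<sigma> powr s * \<bar>x / \<sigma>\<bar> powr s = \<bar>x\<bar> powr s" for x
      using \<sigma>(1) by (simp add: powr_mult[symmetric])
    ultimately show ?thesis by (simp add: sum_J sq_J mult.commute)
  qed
qed

section \<open>The cone of squared forms and Gaussian rounding\<close>

text \<open>The cone generated by these vectors consists of the pairs of diagonals of \<open>A X A\<^sup>T\<close> and \<open>B X B\<^sup>T\<close> with \<open>X\<close>
  positive semidefinite, since such \<open>X\<close> are the sums of matrices \<open>x x\<^sup>T\<close>. Working with the cone avoids
  the matrices \<open>X\<close> and their square roots.\<close>
definition moments :: "real ^ 'n ^ 'm \<Rightarrow> real ^ 'n ^ 'l \<Rightarrow> real ^ 'n \<Rightarrow> (real ^ 'm) \<times> (real ^ 'l)" where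
  "moments A B x = ((\<chi> i. ((A *v x) $ i)\<^sup>2), (\<chi> j. ((B *v x) $ j)\<^sup>2))"

text \<open>Generators are taken from the unit sphere, so that their convex hull is compact.\<close>
definition moment_cone :: "real ^ 'n ^ 'm \<Rightarrow> real ^ 'n ^ 'l \<Rightarrow> ((real ^ 'm) \<times> (real ^ 'l)) set" where
  "moment_cone A B = convex_cone hull (moments A B ` sphere 0 1)"

lemma moments_scaleR: "moments A B (t *\<^sub>R x) = t\<^sup>2 *\<^sub>R moments A B x"
  by (simp add: moments_def matrix_vector_mult_scaleR vec_eq_iff power_mult_distrib)

lemma convex_cone_moment_cone: "convex_cone (moment_cone A B)"
  by (simp add: moment_cone_def convex_cone_convex_cone_hull)

lemma moments_in_moment_cone: "moments A B x \<in> moment_cone A B"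
proof (cases "x = 0")
  case True
  then have "moments A B x = 0" using moments_scaleR[of A B 0 x] by simp
  then show ?thesis by (simp add: convex_cone_contains_0 convex_cone_moment_cone)
next
  case False
  have "moments A B (sgn x) \<in> moment_cone A B"
    unfolding moment_cone_def using False by (intro hull_inc imageI) (simp add: norm_sgn)
  then have "(norm x)\<^sup>2 *\<^sub>R moments A B (sgn x) \<in> moment_cone A B"
    by (intro convex_cone_scaleR convex_cone_moment_cone) auto
  then show ?thesis
    using False by (simp add: sgn_div_norm flip: moments_scaleR)
qed

lemma moment_cone_add_moments:
  "z \<in> moment_cone A B \<Longrightarrow> 0 \<le> t \<Longrightarrow> z + t *\<^sub>R moments A B x \<in> moment_cone A B"
  by (intro convex_cone_add convex_cone_scaleR convex_cone_moment_cone moments_in_moment_cone)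

text \<open>Nonnegative coefficients can be absorbed into the generators by scaling these with square roots.\<close>
lemma moment_cone_sum_of_moments:
  assumes "z \<in> moment_cone A B"
  obtains N :: nat and y where "z = (\<Sum>k<N. moments A B (y k))"
proof -
  define S where "S = {sum_list (map (moments A B) xs) | xs. True}"
  have "convex_cone S"
    unfolding convex_cone_iff
  proof (intro conjI ballI allI impI)
    show "0 \<in> S" unfolding S_def by (auto intro: exI[of _ "[]"])
  next
    fix u v assume "u \<in> S" "v \<in> S"
    then obtain xs ys where "u = sum_list (map (moments A B) xs)" "v = sum_list (map (moments A B) ys)"
      by (auto simp: S_def)
    then have "u + v = sum_list (map (moments A B) (xs @ ys))" by simp
    then show "u + v \<in> S" unfolding S_def by blast
  next
    fix u and c :: real assume "u \<in> S" "0 \<le> c"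
    then obtain xs where xs: "u = sum_list (map (moments A B) xs)" by (auto simp: S_def)
    have "c *\<^sub>R u = sum_list (map (moments A B) (map (\<lambda>x. sqrt c *\<^sub>R x) xs))"
      unfolding xs by (induction xs) (use \<open>0 \<le> c\<close> in \<open>auto simp: moments_scaleR scaleR_add_right\<close>)
    then show "c *\<^sub>R u \<in> S" unfolding S_def by blast
  qed
  moreover have "moments A B ` sphere 0 1 \<subseteq> S"
  proof
    fix u assume "u \<in> moments A B ` sphere 0 1"
    then obtain x where "u = sum_list (map (moments A B) [x])" by auto
    then show "u \<in> S" unfolding S_def by blast
  qed
  ultimately have "moment_cone A B \<subseteq> S"
    unfolding moment_cone_def by (rule hull_minimal[rotated])
  then obtain xs where "z = sum_list (map (moments A B) xs)" using assms by (auto simp: S_def)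
  then have "z = (\<Sum>k<length xs. moments A B (xs ! k))"
    by (simp add: sum_list_sum_nth atLeast0LessThan)
  then show ?thesis by (rule that)
qed

lemma fst_sum_moments: "fst (\<Sum>k\<in>I. moments A B (y k)) $ i = (\<Sum>k\<in>I. ((A *v y k) $ i)\<^sup>2)"
  by (simp add: fst_sum moments_def)

lemma snd_sum_moments: "snd (\<Sum>k\<in>I. moments A B (y k)) $ j = (\<Sum>k\<in>I. ((B *v y k) $ j)\<^sup>2)"
  by (simp add: snd_sum moments_def)

lemma moment_cone_nonneg:
  assumes "z \<in> moment_cone A B"
  shows "0 \<le> fst z $ i" "0 \<le> snd z $ j"
  by (rule moment_cone_sum_of_moments[OF assms]; simp add: fst_sum_moments snd_sum_moments sum_nonneg)+

text \<open>If \<open>z\<close> is the sum of the moment vectors of \<open>y k\<close>, the random vector \<open>X = \<Sum>k. g k y k\<close> with independent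
  standard normal \<open>g k\<close> has coordinates \<open>(A X) i\<close> and \<open>(B X) j\<close> that are centred normal with variances
  \<open>fst z $ i\<close> and \<open>snd z $ j\<close>. The claim is the expectation of \<open>pnorm 1 (A X) \<le> N * pnorm p (B X)\<close>,
  combined with \<open>E (pnorm p (B X)) \<le> (E (pnorm p (B X) powr p)) powr (1 / p) = gamma_const p\<close>.\<close>
lemma moment_rounding:
  assumes p: "1 \<le> p" and N: "\<And>x. pnorm 1 (A *v x) \<le> N * pnorm (ereal p) (B *v x)" "0 \<le> N"
    and z: "z \<in> moment_cone A B" and norm: "(\<Sum>j\<in>UNIV. snd z $ j powr (p / 2)) = 1"
  shows "gamma_const 1 * (\<Sum>i\<in>UNIV. sqrt (fst z $ i)) \<le> gamma_const p * N"
proof -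
  obtain K :: nat and y where z_eq: "z = (\<Sum>k<K. moments A B (y k))"
    using moment_cone_sum_of_moments[OF z] by metis
  define g where "g = gamma_const p"
  have g: "0 < g" unfolding g_def using p by (intro gamma_const_pos) auto
  define X where "X \<omega> = (\<Sum>k<K. \<omega> k *\<^sub>R y k)" for \<omega> :: "nat \<Rightarrow> real"
  have AX: "(A *v X \<omega>) $ i = (\<Sum>k<K. \<omega> k * (A *v y k) $ i)" for \<omega> i
    by (simp add: X_def matrix_vector_mult_scaleR linear_sum[OF matrix_vector_mul_linear])
  have BX: "(B *v X \<omega>) $ j = (\<Sum>k<K. \<omega> k * (B *v y k) $ j)" for \<omega> j
    by (simp add: X_def matrix_vector_mult_scaleR linear_sum[OF matrix_vector_mul_linear])
  have fst_eq: "fst z $ i = (\<Sum>k<K. ((A *v y k) $ i)\<^sup>2)" for i by (simp add: z_eq fst_sum_moments)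
  have snd_eq: "snd z $ j = (\<Sum>k<K. ((B *v y k) $ j)\<^sup>2)" for j by (simp add: z_eq snd_sum_moments)
  have mA: "has_bochner_integral (gauss {..<K}) (\<lambda>\<omega>. \<Sum>i\<in>UNIV. \<bar>(A *v X \<omega>) $ i\<bar> powr 1)
      (\<Sum>i\<in>UNIV. gamma_const 1 powr 1 * fst z $ i powr (1 / 2))"
    unfolding AX fst_eq by (intro has_bochner_integral_sum gauss_linear_form_moment) auto
  have mB: "has_bochner_integral (gauss {..<K}) (\<lambda>\<omega>. \<Sum>j\<in>UNIV. \<bar>(B *v X \<omega>) $ j\<bar> powr p)
      (\<Sum>j\<in>UNIV. g powr p * snd z $ j powr (p / 2))"
    unfolding BX snd_eq g_def using p by (intro has_bochner_integral_sum gauss_linear_form_moment) auto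
  interpret prob_space "gauss {..<K}" by (rule prob_space_gauss)
  define Y where "Y \<omega> = (\<Sum>j\<in>UNIV. \<bar>(B *v X \<omega>) $ j\<bar> powr p)" for \<omega>
  have pointwise: "(\<Sum>i\<in>UNIV. \<bar>(A *v X \<omega>) $ i\<bar> powr 1) \<le> N * g * (1 / p * (Y \<omega> / g powr p) + (1 - 1 / p))" for \<omega>
  proof -
    have Y0: "0 \<le> Y \<omega>" by (simp add: Y_def sum_nonneg)
    \<comment> \<open>Replacing the root by its tangent at the mean \<open>g powr p\<close> of \<open>Y\<close> takes the place of Jensen's inequality:
      only \<open>Y\<close> itself has to be integrated.\<close>
    have tangent: "Y \<omega> powr (1 / p) \<le> g * (1 / p * (Y \<omega> / g powr p) + (1 - 1 / p))"
    proof (cases "Y \<omega> = 0")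
      case True
      then show ?thesis using p g by simp
    next
      case False
      then have "(Y \<omega> / g powr p) powr (1 / p) * 1 powr (1 - 1 / p) \<le> 1 / p * (Y \<omega> / g powr p) + (1 - 1 / p) * 1"
        using p g Y0 by (intro Youngs_inequality_0) auto
      moreover have "(Y \<omega> / g powr p) powr (1 / p) = Y \<omega> powr (1 / p) / g"
        using p g Y0 by (simp add: powr_divide powr_powr)
      ultimately show ?thesis using g by (simp add: field_simps)
    qed
    have "(\<Sum>i\<in>UNIV. \<bar>(A *v X \<omega>) $ i\<bar> powr 1) = pnorm 1 (A *v X \<omega>)"
      by (simp add: pnorm_1)
    also have "\<dots> \<le> N * Y \<omega> powr (1 / p)"
      using N(1)[of "X \<omega>"] by (simp add: pnorm_ereal Y_def)
    also have "\<dots> \<le> N * (g * (1 / p * (Y \<omega> / g powr p) + (1 - 1 / p)))"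
      by (intro mult_left_mono tangent N)
    finally show ?thesis by (simp add: mult.assoc)
  qed
  have Y_int: "has_bochner_integral (gauss {..<K}) Y (g powr p)"
    using mB norm by (simp add: Y_def[abs_def] flip: sum_distrib_left)
  have "has_bochner_integral (gauss {..<K})
      (\<lambda>\<omega>. N * g * (1 / p * (Y \<omega> / g powr p) + (1 - 1 / p)))
      (N * g * (1 / p * (g powr p / g powr p) + measure (gauss {..<K}) (space (gauss {..<K})) * (1 - 1 / p)))"
    by (intro has_bochner_integral_mult_right has_bochner_integral_add has_bochner_integral_divide_zero Y_int)
       (simp add: has_bochner_integral_iff)
  then have "has_bochner_integral (gauss {..<K})
      (\<lambda>\<omega>. N * g * (1 / p * (Y \<omega> / g powr p) + (1 - 1 / p))) (N * g)"
    using g p by (simp add: prob_space)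
  then have "(\<Sum>i\<in>UNIV. gamma_const 1 powr 1 * fst z $ i powr (1 / 2)) \<le> N * g"
    using mA pointwise by (metis (no_types, lifting) has_bochner_integral_iff integral_mono)
  then show ?thesis
    using moment_cone_nonneg(1)[OF z] gamma_const_pos[of 1]
    by (simp add: powr_half_sqrt sum_distrib_left g_def mult.commute)
qed

section \<open>Optimality conditions and strong duality\<close>

text \<open>Up to the factor \<open>p / 2\<close> this is the derivative of \<open>c powr (p / 2)\<close>. The case \<open>p = 2\<close> is separate because
  \<open>0 powr 0 = 0\<close>, whereas the derivative of the identity at 0 is 1.\<close>
definition half_power_slope :: "real \<Rightarrow> real \<Rightarrow> real" where
  "half_power_slope p c = (if p = 2 then 1 else c powr (p / 2 - 1))"

lemma half_power_slope_nonneg: "0 \<le> half_power_slope p c"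
  by (simp add: half_power_slope_def)

text \<open>The graph of the convex function \<open>\<lambda>c. c powr (p / 2)\<close> lies above its tangent at \<open>u\<close>. Young's inequality
  gives this without differentiating at 0.\<close>
lemma half_power_tangent:
  assumes p: "2 \<le> p" and c: "0 \<le> c" "c \<le> u"
  shows "u powr (p / 2) \<le> c powr (p / 2) + p / 2 * half_power_slope p u * (u - c)"
proof (cases "p = 2 \<or> c = 0")
  case True
  have "u powr (p / 2) \<le> p / 2 * (u powr (p / 2 - 1) * u)" if "0 < u"
  proof -
    have "u powr (p / 2 - 1) * u = u powr (p / 2)"
      using that by (simp add: powr_diff)
    then show ?thesis using p mult_right_mono[of 1 "p / 2" "u powr (p / 2)"] by simp
  qed
  with True p c show ?thesis
    by (cases "u = 0") (auto simp: half_power_slope_def mult.assoc diff_divide_distrib)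
next
  case False
  define r where "r = p / 2"
  have r: "1 < r" using False p by (simp add: r_def)
  have pos: "0 < c" "0 < u" using False c by auto
  have "(u powr r) powr ((r - 1) / r) * (c powr r) powr (1 / r) \<le> (r - 1) / r * u powr r + 1 / r * c powr r"
    using r pos by (intro Youngs_inequality_0) (auto simp: field_simps)
  then have "u powr (r - 1) * c \<le> ((r - 1) * u powr r + c powr r) / r"
    using r pos by (simp add: powr_powr add_divide_distrib)
  then have "r * (u powr (r - 1) * c) \<le> (r - 1) * u powr r + c powr r"
    using r by (simp add: pos_le_divide_eq mult.commute)
  moreover have "u powr (r - 1) * u = u powr r"
    using pos by (simp add: powr_diff)
  ultimately have "u powr r \<le> c powr r + r * u powr (r - 1) * (u - c)"
    by (simp add: algebra_simps)
  then show ?thesis using False by (simp add: half_power_slope_def r_def)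
qed

lemma root_tangent_at_1:
  assumes "1 \<le> p" "0 \<le> z"
  shows "(1 + z) powr (1 / p) \<le> 1 + z / (p :: real)"
proof -
  have "(1 + z) powr (1 / p) * 1 powr (1 - 1 / p) \<le> 1 / p * (1 + z) + (1 - 1 / p) * 1"
    using assms by (intro Youngs_inequality_0) auto
  also have "\<dots> = 1 + z / p" by (simp add: algebra_simps add_divide_distrib)
  finally show ?thesis by simp
qed

text \<open>With \<open>s\<close> the mean of \<open>sqrt \<alpha>\<close> and \<open>sqrt (\<alpha> + t a\<^sup>2)\<close>, twice the increment of the square root is
  \<open>t a\<^sup>2 / s\<close>, and \<open>2 y a \<le> s y\<^sup>2 + a\<^sup>2 / s\<close> is the arithmetic-geometric mean inequality. The bound
  has no \<open>\<alpha>\<close> in a denominator, so it survives \<open>t \<rightarrow> 0\<close> even if \<open>\<alpha> = 0\<close>, where the square root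
  is not differentiable.\<close>
lemma sqrt_increment_bound:
  fixes y a \<alpha> t :: real
  assumes t: "0 < t" and \<alpha>: "0 \<le> \<alpha>"
  shows "t * (2 * (y * a)) \<le> t * ((sqrt (\<alpha> + t * a\<^sup>2) + sqrt \<alpha>) / 2 * y\<^sup>2)
           + 2 * (sqrt (\<alpha> + t * a\<^sup>2) - sqrt \<alpha>)"
proof (cases "a = 0")
  case True
  then show ?thesis using t \<alpha> by simp
next
  case False
  define s where "s = (sqrt (\<alpha> + t * a\<^sup>2) + sqrt \<alpha>) / 2"
  have "0 < \<alpha> + t * a\<^sup>2" using False t \<alpha> by (simp add: add_nonneg_pos)
  then have s: "0 < s" using \<alpha> by (simp add: s_def add_pos_nonneg)
  have "2 * (sqrt (\<alpha> + t * a\<^sup>2) - sqrt \<alpha>) * s = (sqrt (\<alpha> + t * a\<^sup>2))\<^sup>2 - (sqrt \<alpha>)\<^sup>2"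
    unfolding s_def by algebra
  also have "\<dots> = t * a\<^sup>2" using \<open>0 < \<alpha> + t * a\<^sup>2\<close> \<alpha> by simp
  finally have inc: "2 * (sqrt (\<alpha> + t * a\<^sup>2) - sqrt \<alpha>) = t * (a\<^sup>2 / s)"
    using s by (simp add: field_simps)
  have "0 \<le> (s * y - a)\<^sup>2 / s" using s by simp
  also have "\<dots> = s * y\<^sup>2 + a\<^sup>2 / s - 2 * (y * a)"
    using s by (simp add: power2_eq_square field_simps)
  finally have "t * (2 * (y * a)) \<le> t * (s * y\<^sup>2 + a\<^sup>2 / s)"
    using t by (intro mult_left_mono) auto
  then show ?thesis unfolding inc s_def[symmetric] by (simp add: algebra_simps)
qed

text \<open>The hypothesis \<open>le\<close> says that moving from \<open>(\<alpha>, c)\<close> in the direction of the squares of \<open>a\<close> and \<open>b\<close> does not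
  increase the ratio of the sum of the square roots of \<open>\<alpha>\<close> to the square root of the norm of \<open>c\<close> with
  exponent \<open>p / 2\<close>. Bounding the increment of the denominator from above by tangents, and that of the
  numerator from below by quadratic forms, gives \<open>2 (y \<bullet> a) \<le> R t\<close> for every \<open>t > 0\<close>, with a right-hand side
  that is continuous at 0. Its limit is the quadratic inequality that defines \<open>K\<close>.\<close>
lemma first_order_condition:
  fixes \<alpha> a y :: "'i::finite \<Rightarrow> real" and c b :: "'j::finite \<Rightarrow> real"
  assumes p: "2 \<le> p" and \<alpha>: "\<And>i. 0 \<le> \<alpha> i" and c: "\<And>j. 0 \<le> c j"
    and norm: "(\<Sum>j\<in>UNIV. c j powr (p / 2)) = 1"
    and le: "\<And>t. 0 < t \<Longrightarrow> (\<Sum>i\<in>UNIV. sqrt (\<alpha> i + t * (a i)\<^sup>2))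
        \<le> (\<Sum>i\<in>UNIV. sqrt (\<alpha> i)) * (\<Sum>j\<in>UNIV. (c j + t * (b j)\<^sup>2) powr (p / 2)) powr (1 / p)"
  shows "2 * (\<Sum>i\<in>UNIV. y i * a i) \<le> (\<Sum>i\<in>UNIV. sqrt (\<alpha> i) * (y i)\<^sup>2)
      + (\<Sum>j\<in>UNIV. (\<Sum>i\<in>UNIV. sqrt (\<alpha> i)) * half_power_slope p (c j) * (b j)\<^sup>2)"
proof -
  define D where "D = (\<Sum>i\<in>UNIV. sqrt (\<alpha> i))"
  have D: "0 \<le> D" unfolding D_def using \<alpha> by (intro sum_nonneg) auto
  define R where "R t = (\<Sum>i\<in>UNIV. (sqrt (\<alpha> i + t * (a i)\<^sup>2) + sqrt (\<alpha> i)) / 2 * (y i)\<^sup>2)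
      + (\<Sum>j\<in>UNIV. D * half_power_slope p (c j + t * (b j)\<^sup>2) * (b j)\<^sup>2)" for t
  have bound: "2 * (\<Sum>i\<in>UNIV. y i * a i) \<le> R t" if t: "0 < t" for t
  proof -
    define L where "L = (\<Sum>j\<in>UNIV. half_power_slope p (c j + t * (b j)\<^sup>2) * (b j)\<^sup>2)"
    have L: "0 \<le> L" unfolding L_def by (intro sum_nonneg) (simp add: half_power_slope_nonneg)
    have "(\<Sum>j\<in>UNIV. (c j + t * (b j)\<^sup>2) powr (p / 2))
        \<le> (\<Sum>j\<in>UNIV. c j powr (p / 2) + p / 2 * half_power_slope p (c j + t * (b j)\<^sup>2) * (t * (b j)\<^sup>2))"
    proof (rule sum_mono)
      fix j
      show "(c j + t * (b j)\<^sup>2) powr (p / 2)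
          \<le> c j powr (p / 2) + p / 2 * half_power_slope p (c j + t * (b j)\<^sup>2) * (t * (b j)\<^sup>2)"
        using half_power_tangent[OF p c[of j], of "c j + t * (b j)\<^sup>2"] t by simp
    qed
    also have "\<dots> = 1 + p / 2 * t * L"
      by (simp add: sum.distrib norm L_def sum_distrib_left mult_ac)
    finally have "(\<Sum>j\<in>UNIV. (c j + t * (b j)\<^sup>2) powr (p / 2)) powr (1 / p) \<le> (1 + p / 2 * t * L) powr (1 / p)"
      using p by (intro powr_mono2 sum_nonneg) auto
    also have "\<dots> \<le> 1 + (p / 2 * t * L) / p"
      using p t L by (intro root_tangent_at_1) auto
    also have "\<dots> = 1 + t * L / 2" using p by simp
    finally have "(\<Sum>i\<in>UNIV. sqrt (\<alpha> i + t * (a i)\<^sup>2)) \<le> D * (1 + t * L / 2)"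
      using le[OF t] D unfolding D_def[symmetric] by (meson mult_left_mono order_trans)
    then have incr: "2 * ((\<Sum>i\<in>UNIV. sqrt (\<alpha> i + t * (a i)\<^sup>2)) - D) \<le> t * (D * L)"
      by (simp add: algebra_simps)
    have "t * (2 * (\<Sum>i\<in>UNIV. y i * a i)) = (\<Sum>i\<in>UNIV. t * (2 * (y i * a i)))"
      by (simp add: sum_distrib_left)
    also have "\<dots> \<le> (\<Sum>i\<in>UNIV. t * ((sqrt (\<alpha> i + t * (a i)\<^sup>2) + sqrt (\<alpha> i)) / 2 * (y i)\<^sup>2)
           + 2 * (sqrt (\<alpha> i + t * (a i)\<^sup>2) - sqrt (\<alpha> i)))"
      by (intro sum_mono sqrt_increment_bound t \<alpha>)
    also have "\<dots> = t * (\<Sum>i\<in>UNIV. (sqrt (\<alpha> i + t * (a i)\<^sup>2) + sqrt (\<alpha> i)) / 2 * (y i)\<^sup>2)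
           + 2 * ((\<Sum>i\<in>UNIV. sqrt (\<alpha> i + t * (a i)\<^sup>2)) - D)"
      by (simp add: sum.distrib sum_subtractf sum_distrib_left D_def)
    also have "\<dots> \<le> t * R t"
      using incr by (simp add: R_def L_def sum_distrib_left algebra_simps)
    finally show ?thesis using t by simp
  qed
  have slope: "((\<lambda>t. half_power_slope p (c j + t * (b j)\<^sup>2)) \<longlongrightarrow> half_power_slope p (c j)) (at_right 0)" for j
  proof (cases "p = 2")
    case False
    have "((\<lambda>t. c j + t * (b j)\<^sup>2) \<longlongrightarrow> c j + 0 * (b j)\<^sup>2) (at_right 0)"
      by (intro tendsto_intros)
    moreover have "\<forall>\<^sub>F t in at_right 0. 0 \<le> c j + t * (b j)\<^sup>2"
      using c[of j] by (auto intro!: eventually_at_rightI[of 0 1])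
    ultimately have "((\<lambda>t. (c j + t * (b j)\<^sup>2) powr (p / 2 - 1)) \<longlongrightarrow> c j powr (p / 2 - 1)) (at_right 0)"
      using p False by (intro tendsto_powr2) auto
    then show ?thesis using False by (simp add: half_power_slope_def)
  qed (simp add: half_power_slope_def)
  have "(R \<longlongrightarrow> (\<Sum>i\<in>UNIV. (sqrt (\<alpha> i + 0 * (a i)\<^sup>2) + sqrt (\<alpha> i)) / 2 * (y i)\<^sup>2)
      + (\<Sum>j\<in>UNIV. D * half_power_slope p (c j) * (b j)\<^sup>2)) (at_right 0)"
    unfolding R_def[abs_def] by (intro tendsto_intros slope)  simp_all
  then have "2 * (\<Sum>i\<in>UNIV. y i * a i) \<le> (\<Sum>i\<in>UNIV. (sqrt (\<alpha> i + 0 * (a i)\<^sup>2) + sqrt (\<alpha> i)) / 2 * (y i)\<^sup>2)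
      + (\<Sum>j\<in>UNIV. D * half_power_slope p (c j) * (b j)\<^sup>2)"
    by (rule tendsto_lowerbound) (auto intro!: eventually_at_rightI[of 0 1] bound)
  then show ?thesis by (simp add: D_def)
qed

text \<open>Both sides of the inequality are homogeneous of degree \<open>1 / 2\<close> in \<open>u\<close>. It suffices to maximise their ratio over the compact
  base \<open>H\<close> of the cone, where injectivity of \<open>B\<close> keeps the denominator positive, and to rescale the maximiser.\<close>
lemma extremal_moment:
  fixes A :: "real ^ 'n ^ 'm" and B :: "real ^ 'n ^ 'l"
  assumes B: "inj ((*v) B)" and p: "0 < p"
  obtains z where "z \<in> moment_cone A B" "(\<Sum>j\<in>UNIV. snd z $ j powr (p / 2)) = 1"
    "\<And>u. u \<in> moment_cone A B \<Longrightarrow> (\<Sum>i\<in>UNIV. sqrt (fst u $ i))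
      \<le> (\<Sum>i\<in>UNIV. sqrt (fst z $ i)) * (\<Sum>j\<in>UNIV. snd u $ j powr (p / 2)) powr (1 / p)"
proof -
  define F where "F u = (\<Sum>i\<in>UNIV. sqrt (fst u $ i))" for u :: "(real ^ 'm) \<times> (real ^ 'l)"
  define S where "S u = (\<Sum>j\<in>UNIV. snd u $ j powr (p / 2))" for u :: "(real ^ 'm) \<times> (real ^ 'l)"
  define H where "H = convex hull (moments A B ` sphere 0 1)"
  have F_scale: "F (t *\<^sub>R u) = sqrt t * F u" for t u
    by (simp add: F_def real_sqrt_mult sum_distrib_left)
  have ne: "moments A B ` sphere 0 1 \<noteq> {}" by simp
  have cone: "moment_cone A B = {t *\<^sub>R h | t h. 0 \<le> t \<and> h \<in> H}"
    unfolding moment_cone_def convex_cone_hull_separate_nonempty[OF ne] conic_hull_explicit H_def ..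
  have H_cone: "h \<in> moment_cone A B" if "h \<in> H" for h
    unfolding cone using that by (metis (mono_tags, lifting) mem_Collect_eq scaleR_one zero_le_one)
  have S_scale: "S (t *\<^sub>R u) = t powr (p / 2) * S u" if "0 \<le> t" "u \<in> H" for t u
    using that moment_cone_nonneg(2)[OF H_cone[OF that(2)]]
    by (simp add: S_def powr_mult sum_distrib_left)
  have "compact H"
    unfolding H_def moments_def
    by (intro compact_convex_hull compact_continuous_image continuous_intros compact_sphere)
  have S_pos: "0 < S h" if "h \<in> H" for h
  proof -
    have "H \<subseteq> {u. 0 < (\<Sum>j\<in>UNIV. snd u $ j)}"
      unfolding H_def
    proof (rule hull_minimal)
      show "moments A B ` sphere 0 1 \<subseteq> {u. 0 < (\<Sum>j\<in>UNIV. snd u $ j)}"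
      proof clarsimp
        fix x :: "real ^ 'n" assume "norm x = 1"
        then have "B *v x \<noteq> 0" using B by (metis injD matrix_vector_mult_0_right norm_zero zero_neq_one)
        then obtain j where "(B *v x) $ j \<noteq> 0" by (auto simp: vec_eq_iff)
        then have "0 < (\<Sum>j\<in>UNIV. ((B *v x) $ j)\<^sup>2)" by (intro sum_pos2[of _ j]) auto
        then show "0 < (\<Sum>j\<in>UNIV. snd (moments A B x) $ j)" by (simp add: moments_def)
      qed
      show "convex {u :: (real ^ 'm) \<times> (real ^ 'l). 0 < (\<Sum>j\<in>UNIV. snd u $ j)}"
      proof (rule convexI)
        fix h k :: "(real ^ 'm) \<times> (real ^ 'l)" and s t :: real
        assume "h \<in> {u. 0 < (\<Sum>j\<in>UNIV. snd u $ j)}" "k \<in> {u. 0 < (\<Sum>j\<in>UNIV. snd u $ j)}"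
          "0 \<le> s" "0 \<le> t" "s + t = 1"
        then have "0 < s * (\<Sum>j\<in>UNIV. snd h $ j) + t * (\<Sum>j\<in>UNIV. snd k $ j)"
          by (cases "s = 0") (auto intro: add_pos_nonneg)
        then show "s *\<^sub>R h + t *\<^sub>R k \<in> {u. 0 < (\<Sum>j\<in>UNIV. snd u $ j)}"
          by (simp add: sum.distrib sum_distrib_left)
      qed
    qed
    then have "0 < (\<Sum>j\<in>UNIV. snd h $ j)" using that by auto
    then have "\<exists>j. snd h $ j \<noteq> 0" by (metis less_irrefl sum.neutral)
    then obtain j where "snd h $ j \<noteq> 0" ..
    then show ?thesis unfolding S_def by (intro sum_pos2[of _ j]) auto
  qed
  have "continuous_on H F" unfolding F_def[abs_def] by (intro continuous_intros)
  moreover have "continuous_on H S"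
    unfolding S_def[abs_def]
    by (intro continuous_on_sum continuous_on_powr' continuous_intros)
       (use p moment_cone_nonneg(2)[OF H_cone] in auto)
  ultimately have "continuous_on H (\<lambda>h. F h / S h powr (1 / p))"
    by (intro continuous_on_divide continuous_on_powr' continuous_on_const) (use S_pos in force)+
  moreover have "H \<noteq> {}" by (simp add: H_def)
  ultimately have "\<exists>h\<in>H. \<forall>h'\<in>H. F h' / S h' powr (1 / p) \<le> F h / S h powr (1 / p)"
    by (intro continuous_attains_sup \<open>compact H\<close>)
  then obtain h where h: "h \<in> H" "\<And>h'. h' \<in> H \<Longrightarrow> F h' / S h' powr (1 / p) \<le> F h / S h powr (1 / p)"
    by blast
  \<comment> \<open>The exponent is chosen so that \<open>S z = 1\<close>, since \<open>S\<close> is homogeneous of degree \<open>p / 2\<close>.\<close>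
  define \<tau> where "\<tau> = S h powr (- 2 / p)"
  define z where "z = \<tau> *\<^sub>R h"
  have \<tau>: "0 \<le> \<tau>" by (simp add: \<tau>_def)
  have S_z: "S z = 1"
  proof -
    have "\<tau> powr (p / 2) = S h powr (- 1)" using p by (simp add: \<tau>_def powr_powr)
    then show ?thesis
      using S_pos[OF h(1)] by (simp add: z_def S_scale[OF \<tau> h(1)] powr_minus)
  qed
  have F_z: "F z = F h / S h powr (1 / p)"
  proof -
    have "sqrt \<tau> = \<tau> powr (1 / 2)" using \<tau> by (simp add: powr_half_sqrt)
    also have "\<dots> = S h powr (- (1 / p))" by (simp add: \<tau>_def powr_powr)
    also have "\<dots> = 1 / S h powr (1 / p)" by (simp add: powr_minus_divide)
    finally show ?thesis by (simp add: z_def F_scale)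
  qed
  show ?thesis
  proof (rule that[of z])
    show "z \<in> moment_cone A B" unfolding cone z_def using \<tau> h(1) by blast
    show "(\<Sum>j\<in>UNIV. snd z $ j powr (p / 2)) = 1" using S_z by (simp add: S_def)
    fix u assume "u \<in> moment_cone A B"
    then obtain t h' where u: "u = t *\<^sub>R h'" "0 \<le> t" "h' \<in> H" by (auto simp: cone)
    have "S u powr (1 / p) = sqrt t * S h' powr (1 / p)"
      using u S_pos[OF u(3)] p by (simp add: S_scale powr_mult powr_powr powr_half_sqrt)
    moreover have "F h' \<le> F z * S h' powr (1 / p)"
      using h(2)[OF u(3)] S_pos[OF u(3)] by (simp add: F_z pos_divide_le_eq)
    then have "F u \<le> sqrt t * (F z * S h' powr (1 / p))"
      using u(2) by (simp add: u(1) F_scale mult_left_mono)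
    ultimately have "F u \<le> F z * S u powr (1 / p)" by (simp add: mult_ac)
    then show "(\<Sum>i\<in>UNIV. sqrt (fst u $ i))
      \<le> (\<Sum>i\<in>UNIV. sqrt (fst z $ i)) * (\<Sum>j\<in>UNIV. snd u $ j powr (p / 2)) powr (1 / p)"
      by (simp add: F_def S_def)
  qed
qed

text \<open>For \<open>p > 2\<close> the exponents match: \<open>(p / 2 - 1) * (p / (p - 2)) = p / 2\<close>.\<close>
lemma pnorm_half_power_slope:
  assumes p: "2 \<le> p" and D: "0 \<le> D" and c: "\<And>j. 0 \<le> c $ j"
    and norm: "(\<Sum>j\<in>UNIV. c $ j powr (p / 2)) = 1"
  shows "pnorm (dual_half_exponent p) (\<chi> j. D * half_power_slope p (c $ j)) = D"
proof (cases "p = 2")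
  case True
  have "{\<bar>D\<bar> |i. i \<in> (UNIV :: 'a set)} = {D}" using D by auto
  then show ?thesis
    using True by (simp add: dual_half_exponent_def pnorm_def half_power_slope_def infnorm_cart)
next
  case False
  define q where "q = p / (p - 2)"
  have q: "0 < q" "(p / 2 - 1) * q = p / 2" using p False by (auto simp: q_def field_simps)
  have "pnorm (dual_half_exponent p) (\<chi> j. D * half_power_slope p (c $ j))
      = (\<Sum>j\<in>UNIV. D powr q * c $ j powr (p / 2)) powr (1 / q)"
    using False D
    by (simp add: dual_half_exponent_def pnorm_ereal half_power_slope_def abs_mult powr_mult powr_powr q(2)
          flip: q_def del: times_divide_eq_left)
  also have "\<dots> = D"
    using D q by (simp add: sum_distrib_left[symmetric] norm powr_powr)
  finally show ?thesis .
qed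

text \<open>The extremal point \<open>z = (\<alpha>, c)\<close> supplies the feasible pair \<open>v i = sqrt (\<alpha> i)\<close>, \<open>w j = D * c j powr (p / 2 - 1)\<close>
  with \<open>D = \<Sum>i. sqrt (\<alpha> i)\<close>, where \<open>w j = D\<close> if \<open>p = 2\<close>: the first-order condition in all directions of the cone is exactly feasibility,
  and both norms in the objective equal \<open>D\<close>. This is strong duality for the semidefinite programme.\<close>
lemma dual_certificate:
  assumes B: "inj ((*v) B)" and p: "2 \<le> p"
  obtains z v w where "z \<in> moment_cone A B" "(\<Sum>j\<in>UNIV. snd z $ j powr (p / 2)) = 1"
    "(v, w) \<in> feasible_K A B" "sdp_objective p (v, w) = 2 * (\<Sum>i\<in>UNIV. sqrt (fst z $ i))"
proof -
  obtain z where z: "z \<in> moment_cone A B" "(\<Sum>j\<in>UNIV. snd z $ j powr (p / 2)) = 1"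
    and max: "\<And>u. u \<in> moment_cone A B \<Longrightarrow> (\<Sum>i\<in>UNIV. sqrt (fst u $ i))
      \<le> (\<Sum>i\<in>UNIV. sqrt (fst z $ i)) * (\<Sum>j\<in>UNIV. snd u $ j powr (p / 2)) powr (1 / p)"
    using extremal_moment[OF B, of p A] p by auto
  note nonneg = moment_cone_nonneg[OF z(1)]
  define D where "D = (\<Sum>i\<in>UNIV. sqrt (fst z $ i))"
  have D: "0 \<le> D" unfolding D_def using nonneg by (intro sum_nonneg) auto
  define v where "v = (\<chi> i. sqrt (fst z $ i))"
  define w where "w = (\<chi> j. D * half_power_slope p (snd z $ j))"
  have "(v, w) \<in> feasible_K A B"
    unfolding feasible_K_iff
  proof (intro allI)
    fix y x
    have "2 * (\<Sum>i\<in>UNIV. y $ i * (A *v x) $ i) \<le> (\<Sum>i\<in>UNIV. sqrt (fst z $ i) * (y $ i)\<^sup>2)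
      + (\<Sum>j\<in>UNIV. (\<Sum>i\<in>UNIV. sqrt (fst z $ i)) * half_power_slope p (snd z $ j) * ((B *v x) $ j)\<^sup>2)"
    proof (rule first_order_condition[OF p nonneg z(2)])
      fix t :: real assume "0 < t"
      then show "(\<Sum>i\<in>UNIV. sqrt (fst z $ i + t * ((A *v x) $ i)\<^sup>2))
        \<le> (\<Sum>i\<in>UNIV. sqrt (fst z $ i)) * (\<Sum>j\<in>UNIV. (snd z $ j + t * ((B *v x) $ j)\<^sup>2) powr (p / 2)) powr (1 / p)"
        using max[OF moment_cone_add_moments[OF z(1), of t x]] by (simp add: moments_def)
    qed
    then show "2 * (\<Sum>i\<in>UNIV. y $ i * (A *v x) $ i)
        \<le> (\<Sum>i\<in>UNIV. v $ i * (y $ i)\<^sup>2) + (\<Sum>j\<in>UNIV. w $ j * ((B *v x) $ j)\<^sup>2)"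
      by (simp add: v_def w_def D_def)
  qed
  moreover have "sdp_objective p (v, w) = 2 * D"
  proof -
    have "pnorm 1 v = D" using nonneg by (simp add: pnorm_1 v_def D_def)
    moreover have "pnorm (dual_half_exponent p) w = D"
      unfolding w_def by (rule pnorm_half_power_slope[OF p D nonneg(2) z(2)])
    ultimately show ?thesis by (simp add: sdp_objective_def)
  qed
  ultimately show ?thesis using z that unfolding D_def by blast
qed

section \<open>The approximation guarantee\<close>

theorem theorem5p6:
  fixes A :: "real ^ 'n ^ 'm" and B :: "real ^ 'n ^ 'l" and p :: real
  assumes "inj ((*v) B)"
    and "2 \<le> p"
  shows "(\<exists>x. is_arg_max (\<lambda>x. pnorm 1 (A *v x)) (\<lambda>x. pnorm (ereal p) (B *v x) \<le> 1) x)
    \<and> (\<exists>z. is_arg_min (sdp_objective p) (\<lambda>z. z \<in> feasible_K A B) z)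
    \<and> opnorm_p1 p A B \<le> 1 / 2 * (LEAST c. \<exists>z\<in>feasible_K A B. c = sdp_objective p z)
    \<and> 1 / 2 * (LEAST c. \<exists>z\<in>feasible_K A B. c = sdp_objective p z)
        \<le> gamma_const p / gamma_const 1 * opnorm_p1 p A B"
proof -
  have q: "0 < ereal p" using assms(2) by simp
  obtain x where x: "pnorm (ereal p) (B *v x) \<le> 1"
    and x_max: "\<And>x'. pnorm (ereal p) (B *v x') \<le> 1 \<Longrightarrow> pnorm 1 (A *v x') \<le> pnorm 1 (A *v x)"
    using opnorm_attained[OF assms(1), of p A] assms(2) by auto
  have opnorm: "opnorm_p1 p A B = pnorm 1 (A *v x)"
    unfolding opnorm_p1_def using x x_max by (intro Greatest_equality) auto
  obtain u v w where u: "u \<in> moment_cone A B" "(\<Sum>j\<in>UNIV. snd u $ j powr (p / 2)) = 1"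
    and vw: "(v, w) \<in> feasible_K A B" "sdp_objective p (v, w) = 2 * (\<Sum>i\<in>UNIV. sqrt (fst u $ i))"
    using dual_certificate[OF assms] by metis
  obtain z where z: "z \<in> feasible_K A B" "\<And>z'. z' \<in> feasible_K A B \<Longrightarrow> sdp_objective p z \<le> sdp_objective p z'"
    using sdp_minimum_attained[OF assms(2), of A B] vw(1) by blast
  have least: "(LEAST c. \<exists>z\<in>feasible_K A B. c = sdp_objective p z) = sdp_objective p z"
    using z by (intro Least_equality) auto
  have lower: "2 * pnorm 1 (A *v x) \<le> sdp_objective p z"
    using sdp_objective_ge[OF assms(2) _ x] z(1) by (cases z) auto
  have "gamma_const 1 * (\<Sum>i\<in>UNIV. sqrt (fst u $ i)) \<le> gamma_const p * pnorm 1 (A *v x)"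
    using assms(2) by (intro moment_rounding[OF _ _ pnorm_nonneg u] pnorm_le_of_unit_bound[OF assms(1) q] x_max) auto
  then have "(\<Sum>i\<in>UNIV. sqrt (fst u $ i)) \<le> gamma_const p / gamma_const 1 * pnorm 1 (A *v x)"
    using gamma_const_pos[of 1] by (simp add: pos_le_divide_eq mult.commute)
  moreover have "1 / 2 * sdp_objective p z \<le> (\<Sum>i\<in>UNIV. sqrt (fst u $ i))"
    using z(2)[OF vw(1)] vw(2) by simp
  ultimately have upper: "1 / 2 * sdp_objective p z \<le> gamma_const p / gamma_const 1 * pnorm 1 (A *v x)"
    by (rule order_trans[rotated])
  show ?thesis
    unfolding opnorm least
  proof (intro conjI exI)
    show "is_arg_max (\<lambda>x. pnorm 1 (A *v x)) (\<lambda>x. pnorm (ereal p) (B *v x) \<le> 1) x"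
      using x x_max by (auto simp: is_arg_max_def not_less)
    show "is_arg_min (sdp_objective p) (\<lambda>z. z \<in> feasible_K A B) z"
      unfolding is_arg_min_def using z by (metis not_less)
  qed (use lower upper in simp_all)
qed

end
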